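(* Let $R$ be a one-sided Duo ring (that is, Left Duo or Right Duo), let $m,n$ be nonnegative integers, and let $f(x)=\sum_{i=0}^{m} a_i x^i$ and $g(x)=\sum_{j=0}^{n} b_j x^j$ be nonzero polynomials in $R[x]$. If $f(x)g(x)=0$, then $a_0^{n+1}$ and $a_m^{n+1}$ are left annihilators of $g(x)$, i.e. $a_0^{n+1}g(x)=0$ and $a_m^{n+1}g(x)=0$, and $b_0^{m+1}$ and $b_n^{m+1}$ are right annihilators of $f(x)$, i.e. $f(x)b_0^{m+1}=0$ and $f(x)b_n^{m+1}=0$.
   Context: Rings are associative with unity, not necessarily commutative. $R[x]$ is the polynomial ring in one indeterminate $x$ that commutes with all elements of $R$. A ring $R$ is called Left Duo (resp. Right Duo) if every left (resp. right) ideal of $R$ is a two-sided ideal. A ring is one-sided Duo if it is Left Duo or Right Duo. Here "annihilator" only means that the stated product is zero; the annihilating element is not asserted to be nonzero. *)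

theory Defs
  imports "HOL-Algebra.UnivPoly"
begin

locale left_ideal = additive_subgroup I R + ring R for I and R (structure) +
  assumes I_l_closed: "\<lbrakk>a \<in> I; x \<in> carrier R\<rbrakk> \<Longrightarrow> x \<otimes> a \<in> I"

locale right_ideal = additive_subgroup I R + ring R for I and R (structure) +
  assumes I_r_closed: "\<lbrakk>a \<in> I; x \<in> carrier R\<rbrakk> \<Longrightarrow> a \<otimes> x \<in> I"

locale left_duo_ring = ring +
  assumes left_ideal_imp_ideal: "\<And>I. left_ideal I R \<Longrightarrow> ideal I R"

locale right_duo_ring = ring +
  assumes right_ideal_imp_ideal: "\<And>I. right_ideal I R \<Longrightarrow> ideal I R"

definition one_sided_duo_ring :: "('a, 'b) ring_scheme \<Rightarrow> bool"
  where "one_sided_duo_ring R \<longleftrightarrow> left_duo_ring R \<or> right_duo_ring R"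

text \<open>
  An element of \<open>R\<close> acts on \<open>R[x]\<close> from either side as a constant polynomial.
  The scalar product of \<open>UP R\<close> only provides the action from the left.
\<close>

abbreviation const_poly :: "('a, 'b) ring_scheme \<Rightarrow> 'a \<Rightarrow> nat \<Rightarrow> 'a"
  where "const_poly R c \<equiv> monom (UP R) c 0"

end

theory Submission
  imports Defs
begin

text \<open>
  The duo hypothesis enters only through semicommutativity: if \<open>x y = 0\<close> then \<open>x r y = 0\<close> for every
  \<open>r\<close>. In a left duo ring this holds because the left annihilator of \<open>y\<close> is a left ideal, hence
  closed under multiplication by \<open>r\<close> on the right; in a right duo ring the right annihilator of \<open>x\<close>
  serves in the same way.

  Now let \<open>f g = 0\<close> over a semicommutative ring. Strong induction on \<open>j\<close> gives \<open>a\<^sub>0\<^bsup>j+1\<^esup> b\<^sub>j = 0\<close>: the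
  coefficient of degree \<open>j\<close> expresses \<open>a\<^sub>0 b\<^sub>j\<close> as minus the sum of the products \<open>a\<^sub>i b\<^sub>j\<^sub>-\<^sub>i\<close> with \<open>i > 0\<close>,
  and multiplying by \<open>a\<^sub>0\<^bsup>j\<^esup>\<close> on the left kills each of them, since \<open>a\<^sub>0\<^bsup>j\<^esup> b\<^sub>j\<^sub>-\<^sub>i = 0\<close> by induction and
  \<open>a\<^sub>i\<close> may be inserted between the two factors. As \<open>j \<le> n\<close>, the power \<open>a\<^sub>0\<^bsup>n+1\<^esup>\<close> annihilates every \<open>b\<^sub>j\<close>.
  The mirror image of this argument treats \<open>b\<^sub>0\<close>
  (lemmas \<open>head_power_annihilates_right\<close> and \<open>head_power_annihilates_left\<close>).

  The hypothesis on the coefficients is invariant under reversing both sequences, which replaces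
  \<open>f\<close> by \<open>x\<^sup>m f(1/x)\<close> and \<open>g\<close> by \<open>x\<^sup>n g(1/x)\<close>. Reversal exchanges \<open>a\<^sub>0\<close> with \<open>a\<^sub>m\<close> and \<open>b\<^sub>0\<close> with \<open>b\<^sub>n\<close>,
  so the two statements about leading coefficients follow (lemma \<open>reversal\<close>).
\<close>

section \<open>Semicommutative rings\<close>

locale semicommutative_ring = ring +
  assumes insert_factor:
    "\<lbrakk>x \<in> carrier R; y \<in> carrier R; r \<in> carrier R; x \<otimes> y = \<zero>\<rbrakk> \<Longrightarrow> x \<otimes> r \<otimes> y = \<zero>"

lemma (in ring) left_annihilator_left_ideal:
  assumes "y \<in> carrier R"
  shows "left_ideal {x \<in> carrier R. x \<otimes> y = \<zero>} R"
proof -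
  have "subgroup {x \<in> carrier R. x \<otimes> y = \<zero>} (add_monoid R)"
    using assms by (intro add.subgroupI) (auto simp: l_distr l_minus simp flip: a_inv_def)
  then show ?thesis
    using assms
    by (auto intro!: left_ideal.intro additive_subgroupI ring_axioms left_ideal_axioms.intro
        simp: m_assoc)
qed

lemma (in ring) right_annihilator_right_ideal:
  assumes "x \<in> carrier R"
  shows "right_ideal {y \<in> carrier R. x \<otimes> y = \<zero>} R"
proof -
  have "subgroup {y \<in> carrier R. x \<otimes> y = \<zero>} (add_monoid R)"
    using assms by (intro add.subgroupI) (auto simp: r_distr r_minus simp flip: a_inv_def)
  then show ?thesis
    using assms
    by (auto intro!: right_ideal.intro additive_subgroupI ring_axioms right_ideal_axioms.intro
        simp flip: m_assoc)
qed

lemma one_sided_duo_imp_semicommutative: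
  assumes "one_sided_duo_ring R"
  shows "semicommutative_ring R"
proof -
  from assms consider "left_duo_ring R" | "right_duo_ring R"
    by (auto simp: one_sided_duo_ring_def)
  then show ?thesis
  proof cases
    case 1
    then interpret left_duo_ring R .
    show ?thesis
    proof
      fix x y r
      assume xyr: "x \<in> carrier R" "y \<in> carrier R" "r \<in> carrier R" "x \<otimes>\<^bsub>R\<^esub> y = \<zero>\<^bsub>R\<^esub>"
      have "ideal {x \<in> carrier R. x \<otimes>\<^bsub>R\<^esub> y = \<zero>\<^bsub>R\<^esub>} R"
        using xyr by (intro left_ideal_imp_ideal left_annihilator_left_ideal)
      from ideal.I_r_closed[OF this, of x r] xyr
      show "x \<otimes>\<^bsub>R\<^esub> r \<otimes>\<^bsub>R\<^esub> y = \<zero>\<^bsub>R\<^esub>" by simp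
    qed
  next
    case 2
    then interpret right_duo_ring R .
    show ?thesis
    proof
      fix x y r
      assume xyr: "x \<in> carrier R" "y \<in> carrier R" "r \<in> carrier R" "x \<otimes>\<^bsub>R\<^esub> y = \<zero>\<^bsub>R\<^esub>"
      have "ideal {y \<in> carrier R. x \<otimes>\<^bsub>R\<^esub> y = \<zero>\<^bsub>R\<^esub>} R"
        using xyr by (intro right_ideal_imp_ideal right_annihilator_right_ideal)
      from ideal.I_l_closed[OF this, of y r] xyr
      show "x \<otimes>\<^bsub>R\<^esub> r \<otimes>\<^bsub>R\<^esub> y = \<zero>\<^bsub>R\<^esub>" by (simp add: m_assoc)
    qed
  qed
qed

section \<open>Vanishing sums\<close>

lemma (in abelian_monoid) finsum_single_nonzero:
  assumes "finite S" "t \<in> S" "h t \<in> carrier G" "\<And>i. i \<in> S \<Longrightarrow> i \<noteq> t \<Longrightarrow> h i = \<zero>"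
  shows "(\<Oplus>i\<in>S. h i) = h t"
proof -
  have "(\<Oplus>i\<in>S. h i) = (\<Oplus>i\<in>{t}. h i)"
  proof (intro add.finprod_mono_neutral_cong_right)
    show "h \<in> S \<rightarrow> carrier G"
    proof
      fix i assume "i \<in> S"
      with assms(3,4) show "h i \<in> carrier G"
        by (cases "i = t") simp_all
    qed
  qed (use assms in auto)
  with assms show ?thesis by simp
qed

text \<open>
  The two cancellation rules below isolate one summand of a vanishing sum, using a multiplier that
  kills all the others.
\<close>

lemma (in ring) vanishing_sum_isolate_left:
  assumes "finite S" "t \<in> S" "h \<in> S \<rightarrow> carrier R" "(\<Oplus>i\<in>S. h i) = \<zero>" "c \<in> carrier R"
    and "\<And>i. i \<in> S \<Longrightarrow> i \<noteq> t \<Longrightarrow> c \<otimes> h i = \<zero>"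
  shows "c \<otimes> h t = \<zero>"
proof -
  have "c \<otimes> h t = (\<Oplus>i\<in>S. c \<otimes> h i)"
    using assms by (intro finsum_single_nonzero[symmetric]) auto
  also have "\<dots> = c \<otimes> (\<Oplus>i\<in>S. h i)"
    using assms(1,3,5) by (intro finsum_rdistr[symmetric])
  finally show ?thesis using assms by simp
qed

lemma (in ring) vanishing_sum_isolate_right:
  assumes "finite S" "t \<in> S" "h \<in> S \<rightarrow> carrier R" "(\<Oplus>i\<in>S. h i) = \<zero>" "c \<in> carrier R"
    and "\<And>i. i \<in> S \<Longrightarrow> i \<noteq> t \<Longrightarrow> h i \<otimes> c = \<zero>"
  shows "h t \<otimes> c = \<zero>"
proof -
  have "h t \<otimes> c = (\<Oplus>i\<in>S. h i \<otimes> c)"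
    using assms by (intro finsum_single_nonzero[symmetric]) auto
  also have "\<dots> = (\<Oplus>i\<in>S. h i) \<otimes> c"
    using assms(1,3,5) by (intro finsum_ldistr[symmetric])
  finally show ?thesis using assms by simp
qed

lemma (in ring) larger_pow_annihilates_left:
  assumes "x \<in> carrier R" "y \<in> carrier R" "x [^] (s::nat) \<otimes> y = \<zero>" "s \<le> t"
  shows "x [^] t \<otimes> y = \<zero>"
proof -
  have "x [^] t = x [^] (t - s) \<otimes> x [^] s"
    using assms by (simp add: nat_pow_mult)
  with assms show ?thesis by (simp add: m_assoc)
qed

lemma (in ring) larger_pow_annihilates_right:
  assumes "x \<in> carrier R" "y \<in> carrier R" "y \<otimes> x [^] (s::nat) = \<zero>" "s \<le> t"
  shows "y \<otimes> x [^] t = \<zero>"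
proof -
  have "x [^] t = x [^] s \<otimes> x [^] (t - s)"
    using assms by (simp add: nat_pow_mult)
  with assms show ?thesis by (simp flip: m_assoc)
qed

section \<open>Coefficient sequences with vanishing convolution\<close>

text \<open>
  The equation \<open>f g = 0\<close> in terms of coefficients. The index set is cut down to the \<open>i\<close> with
  \<open>i \<le> m\<close> and \<open>k - i \<le> n\<close>, instead of extending both sequences by zero, so that it is mapped to the
  index set for degree \<open>m + n - k\<close> by \<open>i \<mapsto> m - i\<close>.
\<close>

locale vanishing_convolution = semicommutative_ring +
  fixes m n :: nat and a b :: "nat \<Rightarrow> 'a"
  assumes a_closed: "i \<le> m \<Longrightarrow> a i \<in> carrier R"
    and b_closed: "j \<le> n \<Longrightarrow> b j \<in> carrier R"
    and convolution_zero: "(\<Oplus>i\<in>{i. i \<le> m \<and> i \<le> k \<and> k \<le> i + n}. a i \<otimes> b (k - i)) = \<zero>"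
begin

text \<open>
  The exponent grows by one with the index because each \<open>b\<^sub>j\<close> is reached from the earlier ones at
  the cost of one more factor \<open>a\<^sub>0\<close>: the earlier ones are all annihilated by \<open>a\<^sub>0\<^bsup>j\<^esup>\<close>, and the extra
  factor turns \<open>b\<^sub>j\<close> into the summand \<open>a\<^sub>0 b\<^sub>j\<close> of the coefficient of degree \<open>j\<close>.
\<close>

lemma head_power_kills_coefficient:
  "j \<le> n \<Longrightarrow> a 0 [^] Suc j \<otimes> b j = \<zero>"
proof (induction j rule: less_induct)
  case (less j)
  let ?S = "{i. i \<le> m \<and> i \<le> j \<and> j \<le> i + n}"
  have "a 0 [^] j \<otimes> (a 0 \<otimes> b (j - 0)) = \<zero>"
  proof (rule vanishing_sum_isolate_left[where S = ?S and t = 0 and h = "\<lambda>i. a i \<otimes> b (j - i)"])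
    fix i assume i: "i \<in> ?S" "i \<noteq> 0"
    then have "a 0 [^] Suc (j - i) \<otimes> b (j - i) = \<zero>"
      using less by auto
    then have "a 0 [^] j \<otimes> b (j - i) = \<zero>"
      by (rule larger_pow_annihilates_left[rotated 2]) (use i less.prems in \<open>auto intro: a_closed b_closed\<close>)
    then show "a 0 [^] j \<otimes> (a i \<otimes> b (j - i)) = \<zero>"
      using i less.prems insert_factor[of "a 0 [^] j" "b (j - i)" "a i"]
      by (simp add: a_closed b_closed m_assoc)
  qed (use less.prems in \<open>simp_all only: convolution_zero, auto simp: a_closed b_closed\<close>)
  then show ?case
    using less.prems by (simp add: a_closed b_closed m_assoc)
qed

text \<open>
  The mirror image, with \<open>b\<^sub>0\<close> multiplied on the right. The factor that
  semicommutativity inserts between \<open>a\<^sub>l\<close> and the power of \<open>b\<^sub>0\<close> is now the coefficient of \<open>g\<close>.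
\<close>

lemma coefficient_killed_by_head_power:
  "i \<le> m \<Longrightarrow> a i \<otimes> b 0 [^] Suc i = \<zero>"
proof (induction i rule: less_induct)
  case (less i)
  let ?S = "{l. l \<le> m \<and> l \<le> i \<and> i \<le> l + n}"
  have "a i \<otimes> b (i - i) \<otimes> b 0 [^] i = \<zero>"
  proof (rule vanishing_sum_isolate_right[where S = ?S and t = i and h = "\<lambda>l. a l \<otimes> b (i - l)"])
    fix l assume l: "l \<in> ?S" "l \<noteq> i"
    then have "a l \<otimes> b 0 [^] Suc l = \<zero>"
      using less by auto
    then have "a l \<otimes> b 0 [^] i = \<zero>"
      by (rule larger_pow_annihilates_right[rotated 2]) (use l in \<open>auto intro: a_closed b_closed\<close>)
    then show "a l \<otimes> b (i - l) \<otimes> b 0 [^] i = \<zero>"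
      using l by (intro insert_factor) (auto simp: a_closed b_closed)
  qed (use less.prems in \<open>simp_all only: convolution_zero, auto simp: a_closed b_closed\<close>)
  moreover have "b 0 [^] Suc i = b 0 \<otimes> b 0 [^] i"
    by (rule nat_pow_Suc2) (simp add: b_closed)
  ultimately show ?case
    using less.prems by (simp add: a_closed b_closed m_assoc del: nat_pow_Suc)
qed

corollary head_power_annihilates_right:
  "j \<le> n \<Longrightarrow> a 0 [^] (n + 1) \<otimes> b j = \<zero>"
  by (rule larger_pow_annihilates_left[OF _ _ head_power_kills_coefficient]) (auto simp: a_closed b_closed)

corollary head_power_annihilates_left:
  "i \<le> m \<Longrightarrow> a i \<otimes> b 0 [^] (m + 1) = \<zero>"
  by (rule larger_pow_annihilates_right[OF _ _ coefficient_killed_by_head_power])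
    (auto simp: a_closed b_closed)

text \<open>
  The index change \<open>i \<mapsto> m - i\<close> turns the equation of degree \<open>k\<close> for the reversed sequences into the
  equation of degree \<open>m + n - k\<close> for the original ones; for \<open>k > m + n\<close> the sum is empty.
\<close>

lemma reversal: "vanishing_convolution R m n (\<lambda>i. a (m - i)) (\<lambda>j. b (n - j))"
proof
  fix k
  let ?S = "{i. i \<le> m \<and> i \<le> k \<and> k \<le> i + n}"
  show "(\<Oplus>i\<in>?S. a (m - i) \<otimes> b (n - (k - i))) = \<zero>"
  proof (cases "k \<le> m + n")
    case True
    let ?T = "{i. i \<le> m \<and> i \<le> m + n - k \<and> m + n - k \<le> i + n}"
    have "?T = (\<lambda>i. m - i) ` ?S"
    proof (intro equalityI subsetI)
      fix i assume "i \<in> ?T"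
      then show "i \<in> (\<lambda>i. m - i) ` ?S"
        using True by (intro image_eqI[where x = "m - i"]) auto
    qed (use True in auto)
    then have "\<zero> = (\<Oplus>i\<in>(\<lambda>i. m - i) ` ?S. a i \<otimes> b (m + n - k - i))"
      using convolution_zero[of "m + n - k"] by simp
    also have "\<dots> = (\<Oplus>i\<in>?S. a (m - i) \<otimes> b (m + n - k - (m - i)))"
      by (rule finsum_reindex) (auto simp: inj_on_def a_closed b_closed)
    also have "\<dots> = (\<Oplus>i\<in>?S. a (m - i) \<otimes> b (n - (k - i)))"
    proof (rule finsum_cong')
      fix i assume "i \<in> ?S"
      then have "m + n - k - (m - i) = n - (k - i)"
        using True by auto
      then show "a (m - i) \<otimes> b (m + n - k - (m - i)) = a (m - i) \<otimes> b (n - (k - i))"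
        by simp
    qed (auto simp: a_closed b_closed)
    finally show ?thesis by simp
  next
    case False
    then have "?S = {}" by auto
    then show ?thesis by (simp only: finsum_empty)
  qed
qed (auto simp: a_closed b_closed)

end

section \<open>Passage to polynomials\<close>

context UP_ring
begin

lemma coeff_sum_monom:
  assumes "\<And>i. i \<le> m \<Longrightarrow> a i \<in> carrier R"
  shows "coeff P (\<Oplus>\<^bsub>P\<^esub>i\<in>{..m}. monom P (a i) i) k = (if k \<le> m then a k else \<zero>)"
proof -
  have "coeff P (\<Oplus>\<^bsub>P\<^esub>i\<in>{..m}. monom P (a i) i) k = (\<Oplus>i\<in>{..m}. coeff P (monom P (a i) i) k)"
    using assms by (intro coeff_finsum) auto
  also have "\<dots> = (\<Oplus>i\<in>{..m}. if i = k then a i else \<zero>)"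
    using assms by (intro R.finsum_cong') auto
  also have "\<dots> = (if k \<le> m then a k else \<zero>)"
    using assms by (auto simp: R.finsum_single_nonzero[where t = k] intro!: R.add.finprod_one_eqI)
  finally show ?thesis .
qed

text \<open>
  The products omitted on the right-hand side have a factor beyond the degree bound \<open>m\<close> or \<open>n\<close>.
\<close>

lemma coeff_mult_truncated:
  assumes "p \<in> carrier P" "q \<in> carrier P"
    and "\<And>i. m < i \<Longrightarrow> coeff P p i = \<zero>" "\<And>j. n < j \<Longrightarrow> coeff P q j = \<zero>"
  shows "coeff P (p \<otimes>\<^bsub>P\<^esub> q) k
    = (\<Oplus>i\<in>{i. i \<le> m \<and> i \<le> k \<and> k \<le> i + n}. coeff P p i \<otimes> coeff P q (k - i))"
proof -
  have "coeff P p i \<otimes> coeff P q (k - i) = \<zero>" if "\<not> (i \<le> m \<and> k \<le> i + n)" for i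
  proof (cases "i \<le> m")
    case True
    with that assms(1,2) show ?thesis by (simp add: assms(4))
  next
    case False
    with assms(1,2) show ?thesis by (simp add: assms(3))
  qed
  then have "(\<Oplus>i\<in>{..k}. coeff P p i \<otimes> coeff P q (k - i))
    = (\<Oplus>i\<in>{i. i \<le> m \<and> i \<le> k \<and> k \<le> i + n}. coeff P p i \<otimes> coeff P q (k - i))"
    using assms(1,2) by (intro R.add.finprod_mono_neutral_cong_right) auto
  with assms(1,2) show ?thesis by simp
qed

lemma const_mult_eq_zero:
  assumes "c \<in> carrier R" "p \<in> carrier P" "\<And>k. c \<otimes> coeff P p k = \<zero>"
  shows "monom P c 0 \<otimes>\<^bsub>P\<^esub> p = \<zero>\<^bsub>P\<^esub>"
proof (rule up_eqI)
  fix k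
  have "coeff P (monom P c 0 \<otimes>\<^bsub>P\<^esub> p) k = (\<Oplus>i\<in>{..k}. (if 0 = i then c else \<zero>) \<otimes> coeff P p (k - i))"
    using assms by simp
  also have "\<dots> = \<zero>"
    using assms by (intro R.add.finprod_one_eqI) auto
  finally show "coeff P (monom P c 0 \<otimes>\<^bsub>P\<^esub> p) k = coeff P \<zero>\<^bsub>P\<^esub> k" by simp
qed (use assms in auto)

lemma mult_const_eq_zero:
  assumes "c \<in> carrier R" "p \<in> carrier P" "\<And>k. coeff P p k \<otimes> c = \<zero>"
  shows "p \<otimes>\<^bsub>P\<^esub> monom P c 0 = \<zero>\<^bsub>P\<^esub>"
proof (rule up_eqI)
  fix k
  have "coeff P (p \<otimes>\<^bsub>P\<^esub> monom P c 0) k = (\<Oplus>i\<in>{..k}. coeff P p i \<otimes> (if 0 = k - i then c else \<zero>))"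
    using assms by simp
  also have "\<dots> = \<zero>"
    using assms by (intro R.add.finprod_one_eqI) auto
  finally show "coeff P (p \<otimes>\<^bsub>P\<^esub> monom P c 0) k = coeff P \<zero>\<^bsub>P\<^esub> k" by simp
qed (use assms in auto)

end

theorem theorem3:
  fixes R :: "('a, 'b) ring_scheme" (structure)
    and m n :: nat
    and a b :: "nat \<Rightarrow> 'a"
    and f g :: "nat \<Rightarrow> 'a"
  assumes "one_sided_duo_ring R"
    and "\<And>i. i \<le> m \<Longrightarrow> a i \<in> carrier R"
    and "\<And>j. j \<le> n \<Longrightarrow> b j \<in> carrier R"
    and "f = (\<Oplus>\<^bsub>UP R\<^esub>i\<in>{..m}. monom (UP R) (a i) i)"
    and "g = (\<Oplus>\<^bsub>UP R\<^esub>j\<in>{..n}. monom (UP R) (b j) j)"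
    and "f \<noteq> \<zero>\<^bsub>UP R\<^esub>"
    and "g \<noteq> \<zero>\<^bsub>UP R\<^esub>"
    and "f \<otimes>\<^bsub>UP R\<^esub> g = \<zero>\<^bsub>UP R\<^esub>"
  shows "const_poly R (a 0 [^] (n + 1)) \<otimes>\<^bsub>UP R\<^esub> g = \<zero>\<^bsub>UP R\<^esub>
       \<and> const_poly R (a m [^] (n + 1)) \<otimes>\<^bsub>UP R\<^esub> g = \<zero>\<^bsub>UP R\<^esub>
       \<and> f \<otimes>\<^bsub>UP R\<^esub> const_poly R (b 0 [^] (m + 1)) = \<zero>\<^bsub>UP R\<^esub>
       \<and> f \<otimes>\<^bsub>UP R\<^esub> const_poly R (b n [^] (m + 1)) = \<zero>\<^bsub>UP R\<^esub>"
proof -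
  interpret R: semicommutative_ring R
    using assms(1) by (rule one_sided_duo_imp_semicommutative)
  interpret UP_ring R "UP R"
    by (simp add: UP_ring.intro R.ring_axioms)
  have f: "f \<in> carrier (UP R)" and g: "g \<in> carrier (UP R)"
    unfolding assms(4,5) using assms(2,3) by (auto intro!: P.finsum_closed)
  have coeff_f: "coeff (UP R) f k = (if k \<le> m then a k else \<zero>)" for k
    unfolding assms(4) by (rule coeff_sum_monom) (rule assms(2))
  have coeff_g: "coeff (UP R) g k = (if k \<le> n then b k else \<zero>)" for k
    unfolding assms(5) by (rule coeff_sum_monom) (rule assms(3))
  interpret forward: vanishing_convolution R m n a b
  proof
    fix k
    let ?S = "{i. i \<le> m \<and> i \<le> k \<and> k \<le> i + n}"
    have "(\<Oplus>i\<in>?S. a i \<otimes> b (k - i)) = (\<Oplus>i\<in>?S. coeff (UP R) f i \<otimes> coeff (UP R) g (k - i))"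
      using assms(2,3) by (intro R.finsum_cong') (auto simp: coeff_f coeff_g)
    also have "\<dots> = coeff (UP R) (f \<otimes>\<^bsub>UP R\<^esub> g) k"
      using f g by (intro coeff_mult_truncated[symmetric]) (auto simp: coeff_f coeff_g)
    finally show "(\<Oplus>i\<in>?S. a i \<otimes> b (k - i)) = \<zero>"
      using assms(8) by simp
  qed (use assms(2,3) in auto)
  interpret backward: vanishing_convolution R m n "\<lambda>i. a (m - i)" "\<lambda>j. b (n - j)"
    by (rule forward.reversal)
  have "a m [^] (n + 1) \<otimes> b j = \<zero>" if "j \<le> n" for j
    using backward.head_power_annihilates_right[of "n - j"] that by simp
  moreover have "a i \<otimes> b n [^] (m + 1) = \<zero>" if "i \<le> m" for i
    using backward.head_power_annihilates_left[of "m - i"] that by simp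
  ultimately show ?thesis
    using forward.head_power_annihilates_right forward.head_power_annihilates_left
      f g assms(2,3)
    by (intro conjI const_mult_eq_zero mult_const_eq_zero)
      (auto simp: coeff_f coeff_g simp del: nat_pow_Suc)
qed

end
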